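(* For every integer $s\geq 3$ there exists $n_0(s)$ such that the following holds. Let $k$ be an integer with $3\leq k\leq s$, let $n>n_0(s)$, and let $\mathcal F\subset \binom{[n]}{k}\cup\binom{[n]}{k+1}\cup\dots\cup\binom{[n]}{s}$ be a family such that for every two distinct sets $A,B\in\mathcal F$ we have $1\leq |A\cap B|\leq k-1$. Then \[ |\mathcal F|\leq \binom{n-1}{k-1}. \]
   Context: $[n]=\{1,2,\dots,n\}$, and $\binom{[n]}{i}$ denotes the family of all $i$-element subsets of $[n]$. *)

theory Defs
  imports Complex_Main "HOL-Library.Ramsey"
begin

end

theory Submission
  imports Defs
begin

text \<open>
  Since two members share at most \<open>k - 1\<close> elements, a \<open>k\<close>-set lies in at most one of them, so at most
  \<open>(n - t) choose (k - t)\<close> members contain a given \<open>t\<close>-set. If the family has a common element, take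
  \<open>t = 1\<close>. Otherwise fix a member \<open>A\<close>, and for each \<open>x \<in> A\<close> a member \<open>D x\<close> avoiding \<open>x\<close>: every
  member contains some \<open>x \<in> A\<close> and some \<open>y \<in> D x\<close>, so there are at most
  \<open>s\<^sup>2 * ((n - 2) choose (k - 2))\<close> members, which is of smaller order in \<open>n\<close>.
\<close>

text \<open>Pick in each member \<open>A\<close> a set \<open>g A\<close> of
  \<open>k - card T\<close> elements outside \<open>T\<close>. Then \<open>T \<union> g A\<close> is
  a \<open>k\<close>-set inside \<open>A\<close>, and no other member contains it, so
  \<open>g\<close> is an injection into the subsets of \<open>X - T\<close> of that size.\<close>

lemma card_superset_family_le:
  fixes F :: "'a set set"
  assumes X: "finite X" and F: "\<And>A. A \<in> F \<Longrightarrow> A \<subseteq> X \<and> T \<subseteq> A \<and> k \<le> card A"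
    and T: "T \<subseteq> X" "card T \<le> k"
    and inter: "\<And>A B. A \<in> F \<Longrightarrow> B \<in> F \<Longrightarrow> A \<noteq> B \<Longrightarrow> card (A \<inter> B) < k"
  shows "card F \<le> (card X - card T) choose (k - card T)"
proof -
  have fT: "finite T" using T X finite_subset by blast
  have "\<exists>S. S \<subseteq> A - T \<and> card S = k - card T" if "A \<in> F" for A
  proof -
    have "k - card T \<le> card (A - T)"
      using F[OF that] fT by (simp add: card_Diff_subset diff_le_mono)
    then show ?thesis by (meson obtain_subset_with_card_n)
  qed
  then obtain g where g: "\<And>A. A \<in> F \<Longrightarrow> g A \<subseteq> A - T \<and> card (g A) = k - card T"
    by metis
  have "inj_on g F"
  proof (rule inj_onI, rule ccontr)
    fix A B assume AB: "A \<in> F" "B \<in> F" "g A = g B" "A \<noteq> B"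
    have fA: "finite A" using F[OF AB(1)] X finite_subset by blast
    have "card (T \<union> g A) = k"
      using g[OF AB(1)] fT fA T(2) by (subst card_Un_disjoint) (auto intro: finite_subset)
    moreover have "T \<union> g A \<subseteq> A \<inter> B"
      using g[OF AB(1)] g[OF AB(2)] F[OF AB(1)] F[OF AB(2)] AB(3) by blast
    ultimately have "k \<le> card (A \<inter> B)"
      using card_mono fA by (metis finite_Int)
    then show False using inter[OF AB(1,2,4)] by simp
  qed
  moreover have "g ` F \<subseteq> {S. S \<subseteq> X - T \<and> card S = k - card T}"
    using g F by blast
  ultimately have "card F \<le> card {S. S \<subseteq> X - T \<and> card S = k - card T}"
    using X by (intro card_inj_on_le) auto
  also have "\<dots> = card (X - T) choose (k - card T)"
    using X by (intro n_subsets) auto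
  finally show ?thesis using fT T by (simp add: card_Diff_subset)
qed

lemma card_nonstar_family_le:
  fixes F :: "'a set set"
  assumes X: "finite X" and F: "\<And>A. A \<in> F \<Longrightarrow> A \<subseteq> X \<and> k \<le> card A \<and> card A \<le> s"
    and k: "2 \<le> k"
    and inter: "\<And>A B. A \<in> F \<Longrightarrow> B \<in> F \<Longrightarrow> A \<noteq> B \<Longrightarrow> A \<inter> B \<noteq> {} \<and> card (A \<inter> B) < k"
    and nonstar: "\<And>x. \<exists>D\<in>F. x \<notin> D"
  shows "card F \<le> s * (s * ((card X - 2) choose (k - 2)))"
proof -
  obtain D where D: "\<And>x. D x \<in> F \<and> x \<notin> D x" using nonstar by metis
  obtain A where A: "A \<in> F" using nonstar by blast
  have fin: "finite B" if "B \<in> F" for B using F[OF that] X finite_subset by blast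
  have pair: "card {B \<in> F. {x, y} \<subseteq> B} \<le> (card X - 2) choose (k - 2)"
    if "x \<in> A" "y \<in> D x" for x y
  proof -
    \<comment> \<open>The points differ because \<open>D x\<close> contains \<open>y\<close> but
      avoids \<open>x\<close>.\<close>
    have xy: "card {x, y} = 2" using that D by (metis card_2_iff)
    have "{x, y} \<subseteq> X" using that F[OF A] F[of "D x"] D by blast
    then have "card {B \<in> F. {x, y} \<subseteq> B} \<le> (card X - card {x, y}) choose (k - card {x, y})"
      using F inter k xy by (intro card_superset_family_le X) auto
    then show ?thesis by (simp only: xy)
  qed
  have "F \<subseteq> (\<Union>x\<in>A. \<Union>y\<in>D x. {B \<in> F. {x, y} \<subseteq> B})"
  proof
    fix B assume B: "B \<in> F"
    \<comment> \<open>This covers the case \<open>B = A\<close>, since \<open>inter\<close> speaks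
      only of distinct members.\<close>
    have "A \<noteq> {}" using F[OF A] k by auto
    then obtain x where x: "x \<in> A" "x \<in> B" using inter[OF A B] by blast
    then have "B \<noteq> D x" using D by blast
    then obtain y where "y \<in> D x" "y \<in> B" using inter[OF B, of "D x"] D by blast
    then show "B \<in> (\<Union>x\<in>A. \<Union>y\<in>D x. {B \<in> F. {x, y} \<subseteq> B})" using x B by blast
  qed
  moreover have "finite F" using F X by (intro finite_subset[of F "Pow X"]) auto
  ultimately have "card F \<le> card (\<Union>x\<in>A. \<Union>y\<in>D x. {B \<in> F. {x, y} \<subseteq> B})"
    using fin A D by (intro card_mono) auto
  also have "\<dots> \<le> (\<Sum>x\<in>A. \<Sum>y\<in>D x. card {B \<in> F. {x, y} \<subseteq> B})"
    using fin[OF A] fin[of "D _"] D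
    by (intro order_trans[OF card_UN_le] sum_mono) (auto intro: card_UN_le)
  also have "\<dots> \<le> (\<Sum>x\<in>A. \<Sum>y\<in>D x. (card X - 2) choose (k - 2))"
    by (intro sum_mono pair)
  also have "\<dots> = (\<Sum>x\<in>A. card (D x) * ((card X - 2) choose (k - 2)))"
    by simp
  also have "\<dots> \<le> (\<Sum>x\<in>A. s * ((card X - 2) choose (k - 2)))"
    using D F by (intro sum_mono mult_right_mono) auto
  also have "\<dots> = card A * (s * ((card X - 2) choose (k - 2)))"
    by simp
  also have "\<dots> \<le> s * (s * ((card X - 2) choose (k - 2)))"
    using F[OF A] by (intro mult_right_mono) auto
  finally show ?thesis .
qed

text \<open>By the absorption identity the right side is \<open>(n - 1) / (k - 1)\<close> times
  \<open>(n - 2) choose (k - 2)\<close>. This ratio is at least \<open>s\<^sup>2\<close>, because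
  \<open>k - 1 \<le> s\<close> and \<open>s ^ 3 \<le> n - 1\<close>.\<close>

lemma square_mult_choose_le:
  fixes s k n :: nat
  assumes "2 \<le> k" "k \<le> s" "s ^ 3 < n"
  shows "s * (s * ((n - 2) choose (k - 2))) \<le> (n - 1) choose (k - 1)"
proof -
  obtain j where j: "k = Suc (Suc j)" using assms(1) by (metis add_2_eq_Suc le_Suc_ex)
  have "0 < s ^ 3" using assms by simp
  then have "2 \<le> n" using assms(3) by linarith
  then obtain m where m: "n = Suc (Suc m)" by (metis add_2_eq_Suc le_Suc_ex)
  \<comment> \<open>Here \<open>Suc j\<close> is \<open>k - 1\<close>; bounding it by
    \<open>s\<close> gives the third factor of \<open>s ^ 3\<close>.\<close>
  have "Suc j * (s * (s * (m choose j))) \<le> s * (s * (s * (m choose j)))"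
    using assms j by (intro mult_right_mono) auto
  also have "\<dots> = s ^ 3 * (m choose j)" by (simp add: power3_eq_cube)
  also have "\<dots> \<le> Suc m * (m choose j)" using assms m by (intro mult_right_mono) auto
  also have "\<dots> = Suc j * (Suc m choose Suc j)" by (simp only: Suc_times_binomial_eq mult.commute)
  finally have "s * (s * (m choose j)) \<le> Suc m choose Suc j"
    by (simp only: mult_le_cancel1)
  then show ?thesis by (simp add: j m)
qed

theorem theorem1p6:
  fixes s :: nat
  assumes "s \<ge> 3"
  shows "\<exists>n0 :: nat. \<forall>(k :: nat) (n :: nat) (F :: nat set set).
           3 \<le> k \<and> k \<le> s \<and> n > n0 \<and>
           F \<subseteq> (\<Union>i\<in>{k..s}. nsets {1..n} i) \<and>
           (\<forall>A\<in>F. \<forall>B\<in>F. A \<noteq> B \<longrightarrow> 1 \<le> card (A \<inter> B) \<and> card (A \<inter> B) \<le> k - 1)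
           \<longrightarrow> card F \<le> (n - 1) choose (k - 1)"
\<comment> \<open>Two factors \<open>s\<close> pay for the choices of \<open>x\<close> and
  \<open>y\<close> in the nonstar case, the third for the denominator \<open>k - 1\<close> in the
  ratio of the binomials.\<close>
proof (intro exI[of _ "s ^ 3"] allI impI, elim conjE)
  fix k n :: nat and F :: "nat set set"
  assume k: "3 \<le> k" "k \<le> s" and n: "s ^ 3 < n"
    and sub: "F \<subseteq> (\<Union>i\<in>{k..s}. nsets {1..n} i)"
    and inter: "\<forall>A\<in>F. \<forall>B\<in>F. A \<noteq> B \<longrightarrow> 1 \<le> card (A \<inter> B) \<and> card (A \<inter> B) \<le> k - 1"
  have F: "A \<subseteq> {1..n} \<and> k \<le> card A \<and> card A \<le> s" if "A \<in> F" for A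
    using sub that by (fastforce simp: nsets_def)
  have int: "A \<inter> B \<noteq> {} \<and> card (A \<inter> B) < k" if AB: "A \<in> F" "B \<in> F" "A \<noteq> B" for A B
  proof -
    have "1 \<le> card (A \<inter> B)" "card (A \<inter> B) \<le> k - 1" using inter AB by blast+
    then show ?thesis using k by auto
  qed
  show "card F \<le> (n - 1) choose (k - 1)"
  proof (cases "\<exists>x. \<forall>A\<in>F. x \<in> A")
    case True
    then obtain x where x: "\<And>A. A \<in> F \<Longrightarrow> x \<in> A" by blast
    show ?thesis
    \<comment> \<open>For an empty family the common element \<open>x\<close> is arbitrary and may
      lie outside \<open>{1..n}\<close>.\<close>
    proof (cases "F = {}")
      case False
      then have "x \<in> {1..n}" using x F by blast
      then show ?thesis
        using card_superset_family_le[of "{1..n}" F "{x}" k] F x int k by simp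
    qed simp
  next
    case False
    then have "card F \<le> s * (s * ((card {1..n} - 2) choose (k - 2)))"
      using F int k by (intro card_nonstar_family_le) auto
    also have "\<dots> \<le> (n - 1) choose (k - 1)"
      using square_mult_choose_le[of k s n] k n by simp
    finally show ?thesis .
  qed
qed

end
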